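(* Let $\mathbf{k}$ be a unitary commutative ring and $\Omega$ a nonempty set. (a) Let $(R,\{P_\omega\mid\omega\in\Omega\})$ be a matching Rota-Baxter algebra of weight $\lambda_\Omega=\{\lambda_\omega\mid\omega\in\Omega\}$. Then $(R,\{\prec_\omega,\succ_\omega\mid\omega\in\Omega\})$ is a matching dendriform algebra, where $$x\prec_\omega y:=xP_\omega(y)+\lambda_\omega xy,\qquad x\succ_\omega y:=P_\omega(x)y,\qquad x,y\in R,\ \omega\in\Omega .$$ (b) Let $(R,\{P_\omega\mid\omega\in\Omega\})$ be a matching Rota-Baxter algebra of weight zero (all $\lambda_\omega=0$). Then $(R,\{\prec_\omega,\succ_\omega\mid\omega\in\Omega\})$ is a matching dendriform algebra, where $$x\prec_\omega y:=xP_\omega(y),\qquad x\succ_\omega y:=P_\omega(x)y,\qquad x,y\in R,\ \omega\in\Omega .$$ (c) Let $(R,\{P_\omega\mid\omega\in\Omega\})$ be a matching Rota-Baxter algebra of weight $\lambda_\Omega=\{\lambda_\omega\mid\omega\in\Omega\}$. Then $(R,\{\prec_\omega,\succ_\omega,\cdot_\omega\mid\omega\in\Omega\})$ is a matching tridendriform algebra, where $$x\prec_\omega y:=xP_\omega(y),\qquad x\succ_\omega y:=P_\omega(x)y,\qquad x\cdot_\omega y:=\lambda_\omega xy,\qquad x,y\in R,\ \omega\in\Omega .$$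
   Context: All modules are over $\mathbf{k}$, all binary operations are $\mathbf{k}$-bilinear, and algebras are associative, possibly without unit. Matching Rota-Baxter algebra: given scalars $\lambda_\Omega=\{\lambda_\omega\mid\omega\in\Omega\}\subseteq\mathbf{k}$, a matching Rota-Baxter algebra of weight $\lambda_\Omega$ is a pair $(R,\{P_\omega\mid\omega\in\Omega\})$ where $R$ is an associative $\mathbf{k}$-algebra and $P_\omega:R\to R$ are $\mathbf{k}$-linear operators such that $$P_\alpha(x)P_\beta(y)=P_\alpha(xP_\beta(y))+P_\beta(P_\alpha(x)y)+\lambda_\beta P_\alpha(xy)\quad\text{for all }x,y\in R,\ \alpha,\beta\in\Omega .$$ A matching dendriform algebra is a module $D$ with binary operations $\{\prec_\omega,\succ_\omega\mid\omega\in\Omega\}$ such that for all $x,y,z\in D$ and $\alpha,\beta\in\Omega$: $$(x\prec_\alpha y)\prec_\beta z=x\prec_\alpha(y\prec_\beta z)+x\prec_\beta(y\succ_\alpha z),$$ $$(x\succ_\alpha y)\prec_\beta z=x\succ_\alpha(y\prec_\beta z),$$ $$(x\prec_\beta y)\succ_\alpha z+(x\succ_\alpha y)\succ_\beta z=x\succ_\alpha(y\succ_\beta z).$$ A matching tridendriform algebra is a module $T$ with binary operations $\{\prec_\omega,\succ_\omega,\cdot_\omega\mid\omega\in\Omega\}$ such that for all $x,y,z\in T$ and $\alpha,\beta\in\Omega$: $$(x\prec_\alpha y)\prec_\beta z=x\prec_\alpha(y\prec_\beta z)+x\prec_\beta(y\succ_\alpha z)+x\prec_\alpha(y\cdot_\beta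 z),$$ $$(x\succ_\alpha y)\prec_\beta z=x\succ_\alpha(y\prec_\beta z),$$ $$x\succ_\alpha(y\succ_\beta z)=(x\prec_\beta y)\succ_\alpha z+(x\succ_\alpha y)\succ_\beta z+(x\cdot_\beta y)\succ_\alpha z,$$ $$(x\succ_\alpha y)\cdot_\beta z=x\succ_\alpha(y\cdot_\beta z),$$ $$(x\prec_\alpha y)\cdot_\beta z=x\cdot_\beta(y\succ_\alpha z),$$ $$(x\cdot_\alpha y)\prec_\beta z=x\cdot_\alpha(y\prec_\beta z),$$ $$(x\cdot_\alpha y)\cdot_\beta z=x\cdot_\alpha(y\cdot_\beta z).$$ *)

theory Defs
  imports "HOL-Algebra.Module"
begin

text \<open>
  Modules over the commutative ring \<open>K\<close> are those of the locale \<^locale>\<open>module\<close>.  Its records also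
  carry multiplication and unit fields, on which that locale imposes nothing.  The unit field
  of \<open>R\<close> is never used below; the multiplication field is used only for associative algebras.
  The library locale \<^locale>\<open>algebra\<close> is not suitable, as it makes algebras commutative and unital.
\<close>

definition linear_op ::
    "('k, 'c) ring_scheme \<Rightarrow> ('k, 'm, 'd) module_scheme \<Rightarrow> ('m \<Rightarrow> 'm) \<Rightarrow> bool" where
  "linear_op K M f \<longleftrightarrow>
     f \<in> carrier M \<rightarrow> carrier M \<and>
     (\<forall>x\<in>carrier M. \<forall>y\<in>carrier M. f (x \<oplus>\<^bsub>M\<^esub> y) = f x \<oplus>\<^bsub>M\<^esub> f y) \<and>
     (\<forall>c\<in>carrier K. \<forall>x\<in>carrier M. f (c \<odot>\<^bsub>M\<^esub> x) = c \<odot>\<^bsub>M\<^esub> f x)"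

definition bilinear_op ::
    "('k, 'c) ring_scheme \<Rightarrow> ('k, 'm, 'd) module_scheme \<Rightarrow> ('m \<Rightarrow> 'm \<Rightarrow> 'm) \<Rightarrow> bool" where
  "bilinear_op K M g \<longleftrightarrow>
     (\<forall>y\<in>carrier M. linear_op K M (\<lambda>x. g x y)) \<and>
     (\<forall>x\<in>carrier M. linear_op K M (\<lambda>y. g x y))"

locale assoc_algebra = module K R
  for K :: "('k, 'c) ring_scheme" and R :: "('k, 'm, 'd) module_scheme" +
  assumes mult_bilinear: "bilinear_op K R (mult R)"
    and mult_assoc:
      "\<lbrakk>x \<in> carrier R; y \<in> carrier R; z \<in> carrier R\<rbrakk> \<Longrightarrow>
        (x \<otimes>\<^bsub>R\<^esub> y) \<otimes>\<^bsub>R\<^esub> z = x \<otimes>\<^bsub>R\<^esub> (y \<otimes>\<^bsub>R\<^esub> z)"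

text \<open>Families indexed by \<open>\<Omega>\<close> are total functions of which only the values on \<open>\<Omega>\<close> matter.\<close>

locale matching_rota_baxter_algebra = assoc_algebra K R
  for K :: "('k, 'c) ring_scheme" and \<Omega> :: "'w set" and wt :: "'w \<Rightarrow> 'k"
    and R :: "('k, 'm, 'd) module_scheme" and P :: "'w \<Rightarrow> 'm \<Rightarrow> 'm" +
  assumes weight_closed: "\<omega> \<in> \<Omega> \<Longrightarrow> wt \<omega> \<in> carrier K"
    and operator_linear: "\<omega> \<in> \<Omega> \<Longrightarrow> linear_op K R (P \<omega>)"
    and rota_baxter:
      "\<lbrakk>\<alpha> \<in> \<Omega>; \<beta> \<in> \<Omega>; x \<in> carrier R; y \<in> carrier R\<rbrakk> \<Longrightarrow>
        P \<alpha> x \<otimes>\<^bsub>R\<^esub> P \<beta> y =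
          P \<alpha> (x \<otimes>\<^bsub>R\<^esub> P \<beta> y) \<oplus>\<^bsub>R\<^esub> P \<beta> (P \<alpha> x \<otimes>\<^bsub>R\<^esub> y) \<oplus>\<^bsub>R\<^esub> wt \<beta> \<odot>\<^bsub>R\<^esub> P \<alpha> (x \<otimes>\<^bsub>R\<^esub> y)"

locale matching_dendriform_algebra = module K D
  for K :: "('k, 'c) ring_scheme" and \<Omega> :: "'w set" and D :: "('k, 'm, 'd) module_scheme"
    and prec :: "'w \<Rightarrow> 'm \<Rightarrow> 'm \<Rightarrow> 'm" and succ :: "'w \<Rightarrow> 'm \<Rightarrow> 'm \<Rightarrow> 'm" +
  assumes prec_bilinear: "\<omega> \<in> \<Omega> \<Longrightarrow> bilinear_op K D (prec \<omega>)"
    and succ_bilinear: "\<omega> \<in> \<Omega> \<Longrightarrow> bilinear_op K D (succ \<omega>)"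
    and prec_prec:
      "\<lbrakk>\<alpha> \<in> \<Omega>; \<beta> \<in> \<Omega>; x \<in> carrier D; y \<in> carrier D; z \<in> carrier D\<rbrakk> \<Longrightarrow>
        prec \<beta> (prec \<alpha> x y) z =
          prec \<alpha> x (prec \<beta> y z) \<oplus>\<^bsub>D\<^esub> prec \<beta> x (succ \<alpha> y z)"
    and succ_prec:
      "\<lbrakk>\<alpha> \<in> \<Omega>; \<beta> \<in> \<Omega>; x \<in> carrier D; y \<in> carrier D; z \<in> carrier D\<rbrakk> \<Longrightarrow>
        prec \<beta> (succ \<alpha> x y) z =
          succ \<alpha> x (prec \<beta> y z)"
    and succ_succ:
      "\<lbrakk>\<alpha> \<in> \<Omega>; \<beta> \<in> \<Omega>; x \<in> carrier D; y \<in> carrier D; z \<in> carrier D\<rbrakk> \<Longrightarrow>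
        succ \<alpha> (prec \<beta> x y) z \<oplus>\<^bsub>D\<^esub> succ \<beta> (succ \<alpha> x y) z =
          succ \<alpha> x (succ \<beta> y z)"

locale matching_tridendriform_algebra = module K T
  for K :: "('k, 'c) ring_scheme" and \<Omega> :: "'w set" and T :: "('k, 'm, 'd) module_scheme"
    and prec :: "'w \<Rightarrow> 'm \<Rightarrow> 'm \<Rightarrow> 'm" and succ :: "'w \<Rightarrow> 'm \<Rightarrow> 'm \<Rightarrow> 'm"
    and dot :: "'w \<Rightarrow> 'm \<Rightarrow> 'm \<Rightarrow> 'm" +
  assumes prec_bilinear: "\<omega> \<in> \<Omega> \<Longrightarrow> bilinear_op K T (prec \<omega>)"
    and succ_bilinear: "\<omega> \<in> \<Omega> \<Longrightarrow> bilinear_op K T (succ \<omega>)"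
    and dot_bilinear: "\<omega> \<in> \<Omega> \<Longrightarrow> bilinear_op K T (dot \<omega>)"
    and prec_prec:
      "\<lbrakk>\<alpha> \<in> \<Omega>; \<beta> \<in> \<Omega>; x \<in> carrier T; y \<in> carrier T; z \<in> carrier T\<rbrakk> \<Longrightarrow>
        prec \<beta> (prec \<alpha> x y) z =
          prec \<alpha> x (prec \<beta> y z) \<oplus>\<^bsub>T\<^esub> prec \<beta> x (succ \<alpha> y z) \<oplus>\<^bsub>T\<^esub> prec \<alpha> x (dot \<beta> y z)"
    and succ_prec:
      "\<lbrakk>\<alpha> \<in> \<Omega>; \<beta> \<in> \<Omega>; x \<in> carrier T; y \<in> carrier T; z \<in> carrier T\<rbrakk> \<Longrightarrow>
        prec \<beta> (succ \<alpha> x y) z =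
          succ \<alpha> x (prec \<beta> y z)"
    and succ_succ:
      "\<lbrakk>\<alpha> \<in> \<Omega>; \<beta> \<in> \<Omega>; x \<in> carrier T; y \<in> carrier T; z \<in> carrier T\<rbrakk> \<Longrightarrow>
        succ \<alpha> x (succ \<beta> y z) =
          succ \<alpha> (prec \<beta> x y) z \<oplus>\<^bsub>T\<^esub> succ \<beta> (succ \<alpha> x y) z \<oplus>\<^bsub>T\<^esub> succ \<alpha> (dot \<beta> x y) z"
    and succ_dot:
      "\<lbrakk>\<alpha> \<in> \<Omega>; \<beta> \<in> \<Omega>; x \<in> carrier T; y \<in> carrier T; z \<in> carrier T\<rbrakk> \<Longrightarrow>
        dot \<beta> (succ \<alpha> x y) z =
          succ \<alpha> x (dot \<beta> y z)"
    and prec_dot: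
      "\<lbrakk>\<alpha> \<in> \<Omega>; \<beta> \<in> \<Omega>; x \<in> carrier T; y \<in> carrier T; z \<in> carrier T\<rbrakk> \<Longrightarrow>
        dot \<beta> (prec \<alpha> x y) z =
          dot \<beta> x (succ \<alpha> y z)"
    and dot_prec:
      "\<lbrakk>\<alpha> \<in> \<Omega>; \<beta> \<in> \<Omega>; x \<in> carrier T; y \<in> carrier T; z \<in> carrier T\<rbrakk> \<Longrightarrow>
        prec \<beta> (dot \<alpha> x y) z =
          dot \<alpha> x (prec \<beta> y z)"
    and dot_dot:
      "\<lbrakk>\<alpha> \<in> \<Omega>; \<beta> \<in> \<Omega>; x \<in> carrier T; y \<in> carrier T; z \<in> carrier T\<rbrakk> \<Longrightarrow>
        dot \<beta> (dot \<alpha> x y) z =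
          dot \<alpha> x (dot \<beta> y z)"

end

theory Submission
  imports Defs
begin

text \<open>
  The tridendriform identities of (c) are associativity, bilinearity and the Rota-Baxter
  equation multiplied by a third element.  Adding the operation \<open>\<cdot>\<^sub>\<omega>\<close> to \<open>\<prec>\<^sub>\<omega>\<close> turns any matching
  tridendriform algebra into a matching dendriform one, which gives (a); in weight zero the
  operation \<open>\<cdot>\<^sub>\<omega>\<close> vanishes, which gives (b).
\<close>

lemma linear_opI:
  assumes "\<And>x. x \<in> carrier M \<Longrightarrow> f x \<in> carrier M"
    and "\<And>x y. \<lbrakk>x \<in> carrier M; y \<in> carrier M\<rbrakk> \<Longrightarrow> f (x \<oplus>\<^bsub>M\<^esub> y) = f x \<oplus>\<^bsub>M\<^esub> f y"
    and "\<And>c x. \<lbrakk>c \<in> carrier K; x \<in> carrier M\<rbrakk> \<Longrightarrow> f (c \<odot>\<^bsub>M\<^esub> x) = c \<odot>\<^bsub>M\<^esub> f x"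
  shows "linear_op K M f"
  using assms unfolding linear_op_def by blast

lemma linear_opD:
  assumes "linear_op K M f"
  shows "x \<in> carrier M \<Longrightarrow> f x \<in> carrier M"
    and "\<lbrakk>x \<in> carrier M; y \<in> carrier M\<rbrakk> \<Longrightarrow> f (x \<oplus>\<^bsub>M\<^esub> y) = f x \<oplus>\<^bsub>M\<^esub> f y"
    and "\<lbrakk>c \<in> carrier K; x \<in> carrier M\<rbrakk> \<Longrightarrow> f (c \<odot>\<^bsub>M\<^esub> x) = c \<odot>\<^bsub>M\<^esub> f x"
  using assms unfolding linear_op_def by blast+

lemma bilinear_opI:
  assumes "\<And>y. y \<in> carrier M \<Longrightarrow> linear_op K M (\<lambda>x. g x y)"
    and "\<And>x. x \<in> carrier M \<Longrightarrow> linear_op K M (\<lambda>y. g x y)"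
  shows "bilinear_op K M g"
  using assms unfolding bilinear_op_def by blast

lemma bilinear_opD:
  assumes "bilinear_op K M g"
  shows "y \<in> carrier M \<Longrightarrow> linear_op K M (\<lambda>x. g x y)"
    and "x \<in> carrier M \<Longrightarrow> linear_op K M (\<lambda>y. g x y)"
  using assms unfolding bilinear_op_def by blast+

lemma linear_op_comp:
  assumes "linear_op K M f" and "linear_op K M g"
  shows "linear_op K M (\<lambda>x. f (g x))"
  by (rule linear_opI) (simp_all add: linear_opD[OF assms(1)] linear_opD[OF assms(2)])

text \<open>Together with the two lemmas that follow, this gives the bilinearity of the three
  operations in (c): \<open>P \<omega>\<close> is applied to the left or the right factor of the
  product, and scaling by \<open>wt \<omega>\<close> to its value.\<close>

lemma bilinear_op_comp_left:
  assumes "bilinear_op K M g" and "linear_op K M f"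
  shows "bilinear_op K M (\<lambda>x y. g (f x) y)"
  using bilinear_opD[OF assms(1)] linear_op_comp[OF _ assms(2)] linear_opD(1)[OF assms(2)]
  by (intro bilinear_opI) blast+

lemma bilinear_op_comp_right:
  assumes "bilinear_op K M g" and "linear_op K M f"
  shows "bilinear_op K M (\<lambda>x y. g x (f y))"
  using bilinear_opD[OF assms(1)] linear_op_comp[OF _ assms(2)] linear_opD(1)[OF assms(2)]
  by (intro bilinear_opI) blast+

lemma bilinear_op_comp_outer:
  assumes "linear_op K M f" and "bilinear_op K M g"
  shows "bilinear_op K M (\<lambda>x y. f (g x y))"
  using bilinear_opD[OF assms(2)] linear_op_comp[OF assms(1)]
  by (intro bilinear_opI) blast+

context module
begin

text \<open>Commutativity of the base ring gives c(ax) = (ca)x = (ac)x = a(cx), so scaling by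
  \<open>c\<close> is itself linear. In this context \<open>R\<close> is the ring of scalars and
  \<open>M\<close> the module.\<close>

lemma linear_op_smult:
  assumes "c \<in> carrier R"
  shows "linear_op R M (\<lambda>x. c \<odot>\<^bsub>M\<^esub> x)"
proof (rule linear_opI)
  fix a x
  assume "a \<in> carrier R" "x \<in> carrier M"
  with assms show "c \<odot>\<^bsub>M\<^esub> (a \<odot>\<^bsub>M\<^esub> x) = a \<odot>\<^bsub>M\<^esub> (c \<odot>\<^bsub>M\<^esub> x)"
    by (simp add: R.m_comm flip: smult_assoc1)
qed (use assms in \<open>simp_all add: smult_r_distr\<close>)

lemma linear_op_add:
  assumes "linear_op R M f" and "linear_op R M g"
  shows "linear_op R M (\<lambda>x. f x \<oplus>\<^bsub>M\<^esub> g x)"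
  by (rule linear_opI)
    (simp_all add: linear_opD[OF assms(1)] linear_opD[OF assms(2)] smult_r_distr M.a_ac)

lemma bilinear_op_add:
  assumes "bilinear_op R M f" and "bilinear_op R M g"
  shows "bilinear_op R M (\<lambda>x y. f x y \<oplus>\<^bsub>M\<^esub> g x y)"
  by (intro bilinear_opI linear_op_add) (simp_all add: bilinear_opD[OF assms(1)] bilinear_opD[OF assms(2)])

end

text \<open>After expansion by bilinearity, each dendriform identity is a sum or a regrouping of
  tridendriform ones.\<close>

lemma (in matching_tridendriform_algebra) matching_dendriform_add_dot:
  "matching_dendriform_algebra K \<Omega> T (\<lambda>\<omega> x y. prec \<omega> x y \<oplus>\<^bsub>T\<^esub> dot \<omega> x y) succ"
proof unfold_locales
  note bilinear = bilinear_opD[OF prec_bilinear] bilinear_opD[OF succ_bilinear]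
    bilinear_opD[OF dot_bilinear]
  \<comment> \<open>Closure and additivity in each argument let the simplifier expand every
    operation on a sum.\<close>
  note [simp] = bilinear[THEN linear_opD(1)] bilinear[THEN linear_opD(2)]
  {
    fix \<omega>
    assume "\<omega> \<in> \<Omega>"
    then show "bilinear_op K T (\<lambda>x y. prec \<omega> x y \<oplus>\<^bsub>T\<^esub> dot \<omega> x y)"
      by (intro bilinear_op_add prec_bilinear dot_bilinear)
  next
    fix \<omega>
    assume "\<omega> \<in> \<Omega>"
    then show "bilinear_op K T (succ \<omega>)"
      by (rule succ_bilinear)
  next
    fix \<alpha> \<beta> x y z
    assume [simp]: "\<alpha> \<in> \<Omega>" "\<beta> \<in> \<Omega>" "x \<in> carrier T" "y \<in> carrier T" "z \<in> carrier T"
    \<comment> \<open>The left side expands into four nested terms. \<open>prec_prec\<close> turns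
      one of them into three, while \<open>dot_prec\<close>, \<open>prec_dot\<close> and
      \<open>dot_dot\<close> turn each of the others into one; these six are the six terms of the
      expanded right side.\<close>
    show "prec \<beta> (prec \<alpha> x y \<oplus>\<^bsub>T\<^esub> dot \<alpha> x y) z \<oplus>\<^bsub>T\<^esub> dot \<beta> (prec \<alpha> x y \<oplus>\<^bsub>T\<^esub> dot \<alpha> x y) z =
      prec \<alpha> x (prec \<beta> y z \<oplus>\<^bsub>T\<^esub> dot \<beta> y z) \<oplus>\<^bsub>T\<^esub> dot \<alpha> x (prec \<beta> y z \<oplus>\<^bsub>T\<^esub> dot \<beta> y z) \<oplus>\<^bsub>T\<^esub>
      (prec \<beta> x (succ \<alpha> y z) \<oplus>\<^bsub>T\<^esub> dot \<beta> x (succ \<alpha> y z))"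
      by (simp add: prec_prec prec_dot dot_prec dot_dot M.a_ac)
    show "prec \<beta> (succ \<alpha> x y) z \<oplus>\<^bsub>T\<^esub> dot \<beta> (succ \<alpha> x y) z =
      succ \<alpha> x (prec \<beta> y z \<oplus>\<^bsub>T\<^esub> dot \<beta> y z)"
      by (simp add: succ_prec succ_dot)
    \<comment> \<open>Additivity in the first argument splits off the \<open>dot\<close> term,
      leaving the three terms of \<open>succ_succ\<close> in another order.\<close>
    show "succ \<alpha> (prec \<beta> x y \<oplus>\<^bsub>T\<^esub> dot \<beta> x y) z \<oplus>\<^bsub>T\<^esub> succ \<beta> (succ \<alpha> x y) z =
      succ \<alpha> x (succ \<beta> y z)"
      by (simp add: succ_succ M.a_ac)
  }
qed

text \<open>The last terms of \<open>prec_prec\<close> and \<open>succ_succ\<close> are values of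
  bilinear operations with a zero argument, so they vanish and the dendriform identities
  remain.\<close>

lemma (in matching_tridendriform_algebra) matching_dendriform_dot_zero:
  assumes "\<And>\<omega> x y. \<lbrakk>\<omega> \<in> \<Omega>; x \<in> carrier T; y \<in> carrier T\<rbrakk> \<Longrightarrow> dot \<omega> x y = \<zero>\<^bsub>T\<^esub>"
  shows "matching_dendriform_algebra K \<Omega> T prec succ"
proof unfold_locales
  note bilinear = bilinear_opD[OF prec_bilinear] bilinear_opD[OF succ_bilinear]
  note [simp] = bilinear[THEN linear_opD(1)] bilinear[THEN linear_opD(2)]
  {
    fix \<omega>
    assume "\<omega> \<in> \<Omega>"
    then show "bilinear_op K T (prec \<omega>)" "bilinear_op K T (succ \<omega>)"
      by (fact prec_bilinear, fact succ_bilinear)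
  next
    fix \<alpha> \<beta> x y z
    assume [simp]: "\<alpha> \<in> \<Omega>" "\<beta> \<in> \<Omega>" "x \<in> carrier T" "y \<in> carrier T" "z \<in> carrier T"
    \<comment> \<open>Additivity at zero + zero gives f(0) = f(0) + f(0), and cancellation yields
      f(0) = 0; the same argument is used for \<open>succ\<close>.\<close>
    have prec_zero: "prec \<alpha> x \<zero>\<^bsub>T\<^esub> = \<zero>\<^bsub>T\<^esub>"
      using linear_opD(2)[OF bilinear(2), of \<alpha> x "\<zero>\<^bsub>T\<^esub>" "\<zero>\<^bsub>T\<^esub>"] by simp
    have succ_zero: "succ \<alpha> \<zero>\<^bsub>T\<^esub> z = \<zero>\<^bsub>T\<^esub>"
      using linear_opD(2)[OF bilinear(3), of \<alpha> z "\<zero>\<^bsub>T\<^esub>" "\<zero>\<^bsub>T\<^esub>"] by simp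
    show "prec \<beta> (prec \<alpha> x y) z = prec \<alpha> x (prec \<beta> y z) \<oplus>\<^bsub>T\<^esub> prec \<beta> x (succ \<alpha> y z)"
      by (simp add: prec_prec assms prec_zero)
    show "prec \<beta> (succ \<alpha> x y) z = succ \<alpha> x (prec \<beta> y z)"
      by (simp add: succ_prec)
    show "succ \<alpha> (prec \<beta> x y) z \<oplus>\<^bsub>T\<^esub> succ \<beta> (succ \<alpha> x y) z = succ \<alpha> x (succ \<beta> y z)"
      by (simp add: succ_succ assms succ_zero)
  }
qed

text \<open>Multiplying the Rota-Baxter equation by \<open>x\<close> on the left gives
  \<open>prec_prec\<close>, and by \<open>z\<close> on the right gives \<open>succ_succ\<close>. The
  other five identities come from associativity and from moving scalars out of products.\<close>

lemma (in matching_rota_baxter_algebra) matching_tridendriform: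
  "matching_tridendriform_algebra K \<Omega> R
     (\<lambda>\<omega> x y. x \<otimes>\<^bsub>R\<^esub> P \<omega> y)
     (\<lambda>\<omega> x y. P \<omega> x \<otimes>\<^bsub>R\<^esub> y)
     (\<lambda>\<omega> x y. wt \<omega> \<odot>\<^bsub>R\<^esub> (x \<otimes>\<^bsub>R\<^esub> y))"
proof unfold_locales
  note mult_left = bilinear_opD(1)[OF mult_bilinear]
  note mult_right = bilinear_opD(2)[OF mult_bilinear]
  \<comment> \<open>As rewrite rules these bracket products to the right, distribute products and
    operators over sums, and pull scalars out of both.\<close>
  note [simp] = weight_closed mult_assoc
    linear_opD[OF operator_linear] linear_opD[OF mult_left] linear_opD[OF mult_right]
  {
    fix \<omega>
    assume \<omega>: "\<omega> \<in> \<Omega>"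
    show "bilinear_op K R (\<lambda>x y. x \<otimes>\<^bsub>R\<^esub> P \<omega> y)"
      by (rule bilinear_op_comp_right[OF mult_bilinear operator_linear[OF \<omega>]])
    show "bilinear_op K R (\<lambda>x y. P \<omega> x \<otimes>\<^bsub>R\<^esub> y)"
      by (rule bilinear_op_comp_left[OF mult_bilinear operator_linear[OF \<omega>]])
    show "bilinear_op K R (\<lambda>x y. wt \<omega> \<odot>\<^bsub>R\<^esub> (x \<otimes>\<^bsub>R\<^esub> y))"
      by (rule bilinear_op_comp_outer[OF linear_op_smult[OF weight_closed[OF \<omega>]] mult_bilinear])
  next
    fix \<alpha> \<beta> x y z
    assume [simp]: "\<alpha> \<in> \<Omega>" "\<beta> \<in> \<Omega>" "x \<in> carrier R" "y \<in> carrier R" "z \<in> carrier R"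
    show "x \<otimes>\<^bsub>R\<^esub> P \<alpha> y \<otimes>\<^bsub>R\<^esub> P \<beta> z =
      x \<otimes>\<^bsub>R\<^esub> P \<alpha> (y \<otimes>\<^bsub>R\<^esub> P \<beta> z) \<oplus>\<^bsub>R\<^esub> x \<otimes>\<^bsub>R\<^esub> P \<beta> (P \<alpha> y \<otimes>\<^bsub>R\<^esub> z) \<oplus>\<^bsub>R\<^esub>
      x \<otimes>\<^bsub>R\<^esub> P \<alpha> (wt \<beta> \<odot>\<^bsub>R\<^esub> (y \<otimes>\<^bsub>R\<^esub> z))"
      by (simp add: rota_baxter)
    \<comment> \<open>The right-bracketed normal form hides the product of
      \<open>P \<alpha> x\<close> and \<open>P \<beta> y\<close>. Bracketing to the left exposes it,
      so that the Rota-Baxter equation can be substituted before multiplying out by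
      \<open>z\<close>.\<close>
    have "P \<alpha> x \<otimes>\<^bsub>R\<^esub> (P \<beta> y \<otimes>\<^bsub>R\<^esub> z) = (P \<alpha> x \<otimes>\<^bsub>R\<^esub> P \<beta> y) \<otimes>\<^bsub>R\<^esub> z"
      by simp
    also have "\<dots> = P \<alpha> (x \<otimes>\<^bsub>R\<^esub> P \<beta> y) \<otimes>\<^bsub>R\<^esub> z \<oplus>\<^bsub>R\<^esub> P \<beta> (P \<alpha> x \<otimes>\<^bsub>R\<^esub> y) \<otimes>\<^bsub>R\<^esub> z \<oplus>\<^bsub>R\<^esub>
      P \<alpha> (wt \<beta> \<odot>\<^bsub>R\<^esub> (x \<otimes>\<^bsub>R\<^esub> y)) \<otimes>\<^bsub>R\<^esub> z"
      by (subst rota_baxter) (simp_all del: mult_assoc)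
    finally show "P \<alpha> x \<otimes>\<^bsub>R\<^esub> (P \<beta> y \<otimes>\<^bsub>R\<^esub> z) =
      P \<alpha> (x \<otimes>\<^bsub>R\<^esub> P \<beta> y) \<otimes>\<^bsub>R\<^esub> z \<oplus>\<^bsub>R\<^esub> P \<beta> (P \<alpha> x \<otimes>\<^bsub>R\<^esub> y) \<otimes>\<^bsub>R\<^esub> z \<oplus>\<^bsub>R\<^esub>
      P \<alpha> (wt \<beta> \<odot>\<^bsub>R\<^esub> (x \<otimes>\<^bsub>R\<^esub> y)) \<otimes>\<^bsub>R\<^esub> z" .
    \<comment> \<open>The two sides collect the weights in opposite orders. Merging them into one
      scalar reduces the claim to commutativity of \<open>K\<close>, which is
      \<open>R.m_comm\<close> because the locale \<open>module\<close> names its scalar ring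
      \<open>R\<close>.\<close>
    show "wt \<beta> \<odot>\<^bsub>R\<^esub> (wt \<alpha> \<odot>\<^bsub>R\<^esub> (x \<otimes>\<^bsub>R\<^esub> y) \<otimes>\<^bsub>R\<^esub> z) =
      wt \<alpha> \<odot>\<^bsub>R\<^esub> (x \<otimes>\<^bsub>R\<^esub> (wt \<beta> \<odot>\<^bsub>R\<^esub> (y \<otimes>\<^bsub>R\<^esub> z)))"
      by (simp add: R.m_comm flip: smult_assoc1)
    show "P \<alpha> x \<otimes>\<^bsub>R\<^esub> y \<otimes>\<^bsub>R\<^esub> P \<beta> z = P \<alpha> x \<otimes>\<^bsub>R\<^esub> (y \<otimes>\<^bsub>R\<^esub> P \<beta> z)"
      "wt \<beta> \<odot>\<^bsub>R\<^esub> (P \<alpha> x \<otimes>\<^bsub>R\<^esub> y \<otimes>\<^bsub>R\<^esub> z) = P \<alpha> x \<otimes>\<^bsub>R\<^esub> (wt \<beta> \<odot>\<^bsub>R\<^esub> (y \<otimes>\<^bsub>R\<^esub> z))"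
      "wt \<beta> \<odot>\<^bsub>R\<^esub> (x \<otimes>\<^bsub>R\<^esub> P \<alpha> y \<otimes>\<^bsub>R\<^esub> z) = wt \<beta> \<odot>\<^bsub>R\<^esub> (x \<otimes>\<^bsub>R\<^esub> (P \<alpha> y \<otimes>\<^bsub>R\<^esub> z))"
      "wt \<alpha> \<odot>\<^bsub>R\<^esub> (x \<otimes>\<^bsub>R\<^esub> y) \<otimes>\<^bsub>R\<^esub> P \<beta> z = wt \<alpha> \<odot>\<^bsub>R\<^esub> (x \<otimes>\<^bsub>R\<^esub> (y \<otimes>\<^bsub>R\<^esub> P \<beta> z))"
      by simp_all
  }
qed

theorem theorem3p4:
  fixes K :: "('k, 'c) ring_scheme" and \<Omega> :: "'w set" and wt :: "'w \<Rightarrow> 'k"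
    and R :: "('k, 'm, 'd) module_scheme" and P :: "'w \<Rightarrow> 'm \<Rightarrow> 'm"
  assumes "cring K" and "\<Omega> \<noteq> {}"
  shows
    "(matching_rota_baxter_algebra K \<Omega> wt R P \<longrightarrow>
        matching_dendriform_algebra K \<Omega> R
          (\<lambda>\<omega> x y. x \<otimes>\<^bsub>R\<^esub> P \<omega> y \<oplus>\<^bsub>R\<^esub> wt \<omega> \<odot>\<^bsub>R\<^esub> (x \<otimes>\<^bsub>R\<^esub> y))
          (\<lambda>\<omega> x y. P \<omega> x \<otimes>\<^bsub>R\<^esub> y)) \<and>
     (matching_rota_baxter_algebra K \<Omega> (\<lambda>\<omega>. \<zero>\<^bsub>K\<^esub>) R P \<longrightarrow>
        matching_dendriform_algebra K \<Omega> R
          (\<lambda>\<omega> x y. x \<otimes>\<^bsub>R\<^esub> P \<omega> y)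
          (\<lambda>\<omega> x y. P \<omega> x \<otimes>\<^bsub>R\<^esub> y)) \<and>
     (matching_rota_baxter_algebra K \<Omega> wt R P \<longrightarrow>
        matching_tridendriform_algebra K \<Omega> R
          (\<lambda>\<omega> x y. x \<otimes>\<^bsub>R\<^esub> P \<omega> y)
          (\<lambda>\<omega> x y. P \<omega> x \<otimes>\<^bsub>R\<^esub> y)
          (\<lambda>\<omega> x y. wt \<omega> \<odot>\<^bsub>R\<^esub> (x \<otimes>\<^bsub>R\<^esub> y)))"
proof (intro conjI impI)
  assume "matching_rota_baxter_algebra K \<Omega> wt R P"
  \<comment> \<open>This is (c). Its \<open>prec\<close> plus its \<open>dot\<close> is literally
    the operation \<open>prec\<close> of (a), so both parts are instances of facts already
    shown.\<close>
  note tri = matching_rota_baxter_algebra.matching_tridendriform[OF this]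
  show "matching_tridendriform_algebra K \<Omega> R
      (\<lambda>\<omega> x y. x \<otimes>\<^bsub>R\<^esub> P \<omega> y)
      (\<lambda>\<omega> x y. P \<omega> x \<otimes>\<^bsub>R\<^esub> y)
      (\<lambda>\<omega> x y. wt \<omega> \<odot>\<^bsub>R\<^esub> (x \<otimes>\<^bsub>R\<^esub> y))"
    by (fact tri)
  show "matching_dendriform_algebra K \<Omega> R
      (\<lambda>\<omega> x y. x \<otimes>\<^bsub>R\<^esub> P \<omega> y \<oplus>\<^bsub>R\<^esub> wt \<omega> \<odot>\<^bsub>R\<^esub> (x \<otimes>\<^bsub>R\<^esub> y))
      (\<lambda>\<omega> x y. P \<omega> x \<otimes>\<^bsub>R\<^esub> y)"
    by (fact matching_tridendriform_algebra.matching_dendriform_add_dot[OF tri])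
next
  assume "matching_rota_baxter_algebra K \<Omega> (\<lambda>\<omega>. \<zero>\<^bsub>K\<^esub>) R P"
  then interpret matching_rota_baxter_algebra K \<Omega> "\<lambda>\<omega>. \<zero>\<^bsub>K\<^esub>" R P .
  show "matching_dendriform_algebra K \<Omega> R
      (\<lambda>\<omega> x y. x \<otimes>\<^bsub>R\<^esub> P \<omega> y)
      (\<lambda>\<omega> x y. P \<omega> x \<otimes>\<^bsub>R\<^esub> y)"
    \<comment> \<open>For the zero weight, \<open>dot\<close> is the zero scalar times a product. It
      vanishes once the product is known to lie in the carrier, which bilinearity of the
      multiplication provides.\<close>
    by (rule matching_tridendriform_algebra.matching_dendriform_dot_zero[OF matching_tridendriform])
      (simp add: linear_opD(1)[OF bilinear_opD(2)[OF mult_bilinear]])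
qed

end
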